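(* Let $X \xrightarrow{f} Z \xleftarrow{g} Y$ be continuous maps, and let $u\colon X'\to X$, $v\colon Y'\to Y$ be continuous maps. (1) One has $$(\mathrm{TC}(f\circ u,\,g\circ v)+1)\cdot(\mathrm{sec}(u\times v)+1)\ \ge\ \mathrm{TC}(f,g)+1.$$ Therefore, if $u$ and $v$ admit strict sections, then $\mathrm{TC}(f,g)\le \mathrm{TC}(f\circ u,\,g\circ v)$. (2) If $u$ and $v$ are fibrations, then $\mathrm{TC}(f\circ u,\,g\circ v)\le \mathrm{TC}(f,g)$. (3) If $u$ and $v$ are fibrations admitting (homotopy) sections, then $\mathrm{TC}(f\circ u,\,g\circ v)=\mathrm{TC}(f,g)$.
   Context: Fibration means Hurewicz fibration. A strict section of $u\colon X'\to X$ is a map $s\colon X\to X'$ with $u\circ s=\mathrm{id}_X$; a homotopy section is a map $s$ with $u\circ s\simeq\mathrm{id}_X$. All maps are continuous, $I=[0,1]$, and path spaces $X^I$ carry the compact-open topology. For a map $p\colon E\to B$, the sectional number $\mathrm{sec}(p)$ is the least integer $k\ge 0$ such that $B$ has an open cover $U_0,\dots,U_k$ with continuous maps $s_i\colon U_i\to E$ satisfying $p\circ s_i=\mathrm{inc}_{U_i}$ (strict equality); $\mathrm{sec}(p)=\infty$ if no such $k$ exists. For maps $f\colon X\to Z$, $g\colon Y\to Z$ put $\Delta^I_{f,g}=\{(\alpha,\beta)\in X^I\times Y^I : f\circ\alpha=g\circ\beta\}$ and $\pi_{f,g}\colon\Delta^I_{f,g}\to X\times Y$, $\pi_{f,g}(\alpha,\beta)=(\alpha(0),\beta(1))$.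 The bivariate topological complexity is $\mathrm{TC}(f,g):=\mathrm{sec}(\pi_{f,g})$. *)

theory Defs
  imports "HOL-Analysis.Analysis"
begin

text \<open>Spaces are topologies \<^typ>\<open>'a topology\<close> on a subset of a type, so that arbitrary
  spaces and subspaces are covered. Only the values of a map on the \<^const>\<open>topspace\<close> of its
  domain matter.\<close>

abbreviation unit_interval :: "real topology"
  where "unit_interval \<equiv> top_of_set {0..1}"

text \<open>The sets of the generating family are taken inside the set of continuous maps \<open>X \<rightarrow> Y\<close>,
  represented by the functions that are \<^const>\<open>undefined\<close> off \<^term>\<open>topspace X\<close> (so that two
  maps agreeing on \<^term>\<open>topspace X\<close> are equal). The choice \<open>K = {}\<close> makes the whole mapping set
  the \<^const>\<open>topspace\<close>.\<close>

definition maps_set :: "'a topology \<Rightarrow> 'b topology \<Rightarrow> ('a \<Rightarrow> 'b) set"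
  where "maps_set X Y = {\<phi>. \<phi> \<in> extensional (topspace X) \<and> continuous_map X Y \<phi>}"

definition compact_open_topology :: "'a topology \<Rightarrow> 'b topology \<Rightarrow> ('a \<Rightarrow> 'b) topology"
  where "compact_open_topology X Y =
    topology_generated_by {{\<phi> \<in> maps_set X Y. \<phi> ` K \<subseteq> U} | K U. compactin X K \<and> openin Y U}"

definition path_space :: "'a topology \<Rightarrow> (real \<Rightarrow> 'a) topology"
  where "path_space X = compact_open_topology unit_interval X"

definition strict_section :: "'e topology \<Rightarrow> 'b topology \<Rightarrow> ('e \<Rightarrow> 'b) \<Rightarrow> ('b \<Rightarrow> 'e) \<Rightarrow> bool"
  where "strict_section E B p s \<longleftrightarrow> continuous_map B E s \<and> (\<forall>x\<in>topspace B. p (s x) = x)"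

definition homotopy_section :: "'e topology \<Rightarrow> 'b topology \<Rightarrow> ('e \<Rightarrow> 'b) \<Rightarrow> ('b \<Rightarrow> 'e) \<Rightarrow> bool"
  where "homotopy_section E B p s \<longleftrightarrow>
    continuous_map B E s \<and> homotopic_with (\<lambda>_. True) B B (p \<circ> s) id"

text \<open>In \<^typ>\<open>enat\<close>, the infimum of the empty set is \<open>\<infinity>\<close>.\<close>

definition sectional_number :: "'e topology \<Rightarrow> 'b topology \<Rightarrow> ('e \<Rightarrow> 'b) \<Rightarrow> enat"
  where "sectional_number E B p = Inf {enat k | k.
    \<exists>(U :: nat \<Rightarrow> 'b set) (s :: nat \<Rightarrow> 'b \<Rightarrow> 'e).
      (\<forall>i\<le>k. openin B (U i)) \<and> (\<Union>i\<le>k. U i) = topspace B \<and>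
      (\<forall>i\<le>k. continuous_map (subtopology B (U i)) E (s i) \<and> (\<forall>x\<in>U i. p (s i x) = x))}"

definition path_pullback ::
    "'x topology \<Rightarrow> 'y topology \<Rightarrow> ('x \<Rightarrow> 'z) \<Rightarrow> ('y \<Rightarrow> 'z) \<Rightarrow> ((real \<Rightarrow> 'x) \<times> (real \<Rightarrow> 'y)) topology"
  where "path_pullback X Y f g =
    subtopology (prod_topology (path_space X) (path_space Y))
      {(\<alpha>, \<beta>). \<forall>t\<in>{0..1}. f (\<alpha> t) = g (\<beta> t)}"

definition endpoint_map :: "(real \<Rightarrow> 'x) \<times> (real \<Rightarrow> 'y) \<Rightarrow> 'x \<times> 'y"
  where "endpoint_map = (\<lambda>(\<alpha>, \<beta>). (\<alpha> 0, \<beta> 1))"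

definition TC :: "'x topology \<Rightarrow> 'y topology \<Rightarrow> ('x \<Rightarrow> 'z) \<Rightarrow> ('y \<Rightarrow> 'z) \<Rightarrow> enat"
  where "TC X Y f g = sectional_number (path_pullback X Y f g) (prod_topology X Y) endpoint_map"

definition homotopy_lifting :: "'w topology \<Rightarrow> 'e topology \<Rightarrow> 'b topology \<Rightarrow> ('e \<Rightarrow> 'b) \<Rightarrow> bool"
  where "homotopy_lifting W E B p \<longleftrightarrow>
    (\<forall>h H. continuous_map W E h \<and> continuous_map (prod_topology W unit_interval) B H \<and>
           (\<forall>w\<in>topspace W. H (w, 0) = p (h w)) \<longrightarrow>
      (\<exists>L. continuous_map (prod_topology W unit_interval) E L \<and>
           (\<forall>w\<in>topspace W. L (w, 0) = h w) \<and>
           (\<forall>w\<in>topspace W. \<forall>t\<in>{0..1}. p (L (w, t)) = H (w, t))))"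

text \<open>A Hurewicz fibration has the homotopy lifting property for all spaces. A definition in HOL
  cannot quantify over types, so the test spaces range over all topologies on a fixed type, chosen
  large enough to carry the mapping path space of \<open>p\<close>. No generality is lost:
  \<open>hurewicz_fibration_lifting\<close> below derives the property for test spaces on an
  arbitrary type.\<close>

definition hurewicz_fibration :: "'e topology \<Rightarrow> 'b topology \<Rightarrow> ('e \<Rightarrow> 'b) \<Rightarrow> bool"
  where "hurewicz_fibration E B p \<longleftrightarrow>
    continuous_map E B p \<and> (\<forall>W :: ('e \<times> (real \<Rightarrow> 'b)) topology. homotopy_lifting W E B p)"

lemma topspace_compact_open [simp]: "topspace (compact_open_topology X Y) = maps_set X Y"
proof -
  have "maps_set X Y \<in> {{\<phi> \<in> maps_set X Y. \<phi> ` K \<subseteq> U} | K U. compactin X K \<and> openin Y U}"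
    by (rule CollectI, rule exI[of _ "{}"], rule exI[of _ "{}"]) auto
  then show ?thesis
    unfolding compact_open_topology_def topology_generated_by_topspace by blast
qed

lemma continuous_map_path_space_eval:
  "continuous_map (prod_topology (path_space B) unit_interval) B (\<lambda>(\<gamma>, t). \<gamma> t)"
proof -
  have top: "topspace (path_space B) = maps_set unit_interval B"
    by (simp add: path_space_def)
  have "openin (prod_topology (path_space B) unit_interval)
      {z \<in> topspace (prod_topology (path_space B) unit_interval). (\<lambda>(\<gamma>, t). \<gamma> t) z \<in> U}"
    if U: "openin B U" for U
  proof (subst openin_subopen, intro ballI)
    fix z assume "z \<in> {z \<in> topspace (prod_topology (path_space B) unit_interval).
      (\<lambda>(\<gamma>, t). \<gamma> t) z \<in> U}"
    then obtain \<gamma> t where z: "z = (\<gamma>, t)" and \<gamma>: "\<gamma> \<in> maps_set unit_interval B"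
      and t: "t \<in> {0..1}" and gU: "\<gamma> t \<in> U"
      by (auto simp: top)
    from \<gamma> have c: "continuous_map unit_interval B \<gamma>" by (simp add: maps_set_def)
    have "openin unit_interval {s \<in> topspace unit_interval. \<gamma> s \<in> U}"
      using c U by (rule openin_continuous_map_preimage)
    then obtain e where e: "e > 0" and eb: "\<And>s. s \<in> {0..1} \<Longrightarrow> dist s t < e \<Longrightarrow> \<gamma> s \<in> U"
      using t gU unfolding openin_euclidean_subtopology_iff by auto
    define K where "K = {0..1} \<inter> cball t (e/2)"
    define V where "V = {0..1} \<inter> ball t (e/2)"
    have K: "compactin unit_interval K"
      unfolding compactin_subtopology K_def by (auto simp: compact_Int_closed)
    have KU: "\<gamma> ` K \<subseteq> U" using eb e unfolding K_def by (auto simp: dist_commute)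
    have V: "openin unit_interval V" unfolding V_def by (simp add: openin_open_Int)
    have tV: "t \<in> V" using t e by (simp add: V_def)
    let ?N = "{\<phi> \<in> maps_set unit_interval B. \<phi> ` K \<subseteq> U}"
    have N: "openin (path_space B) ?N"
      unfolding path_space_def compact_open_topology_def
      by (rule topology_generated_by_Basis) (use K U in blast)
    have "openin (prod_topology (path_space B) unit_interval) (?N \<times> V)"
      using N V by (simp add: openin_prod_Times_iff)
    moreover have "z \<in> ?N \<times> V" using z \<gamma> KU tV by simp
    moreover have "?N \<times> V \<subseteq> {z \<in> topspace (prod_topology (path_space B) unit_interval).
        (\<lambda>(\<gamma>, t). \<gamma> t) z \<in> U}"
      by (auto simp: top V_def K_def)
    ultimately show "\<exists>T. openin (prod_topology (path_space B) unit_interval) T \<and> z \<in> T \<and>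
        T \<subseteq> {z \<in> topspace (prod_topology (path_space B) unit_interval). (\<lambda>(\<gamma>, t). \<gamma> t) z \<in> U}"
      by blast
  qed
  moreover have "(\<lambda>(\<gamma>, t). \<gamma> t) \<in> topspace (prod_topology (path_space B) unit_interval) \<rightarrow> topspace B"
    by (auto simp: top maps_set_def continuous_map_def)
  ultimately show ?thesis by (simp add: continuous_map_def)
qed

lemma continuous_map_path_space_curry:
  assumes H: "continuous_map (prod_topology W unit_interval) B H"
  shows "continuous_map W (path_space B) (\<lambda>w. restrict (\<lambda>t. H (w, t)) {0..1})"
    (is "continuous_map W _ ?c")
proof -
  have mem: "?c w \<in> maps_set unit_interval B" if w: "w \<in> topspace W" for w
  proof -
    have "continuous_map unit_interval (prod_topology W unit_interval) (\<lambda>t. (w, t))"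
      using w by (simp add: continuous_map_pairwise o_def)
    then have "continuous_map unit_interval B (\<lambda>t. H (w, t))"
      using continuous_map_compose[OF _ H] by (simp add: o_def)
    then have "continuous_map unit_interval B (?c w)"
      by (rule continuous_map_eq) auto
    then show ?thesis by (simp add: maps_set_def)
  qed
  have op: "openin W (?c -` {\<phi> \<in> maps_set unit_interval B. \<phi> ` K \<subseteq> U} \<inter> topspace W)"
    if K: "compactin unit_interval K" and U: "openin B U" for K U
  proof -
    have K01: "K \<subseteq> {0..1}" using compactin_subset_topspace[OF K] by simp
    have cK: "compact_space (subtopology unit_interval K)"
      using K by (simp add: compactin_subspace)
    have "continuous_map (prod_topology W (subtopology unit_interval K))
            (prod_topology W unit_interval) (\<lambda>z. z)"
      by (simp add: prod_topology_subtopology(2) continuous_map_from_subtopology)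
    then have "continuous_map (prod_topology W (subtopology unit_interval K)) B (H \<circ> (\<lambda>z. z))"
      using H by (rule continuous_map_compose)
    then have HK: "continuous_map (prod_topology W (subtopology unit_interval K)) B H"
      by (simp add: o_def)
    let ?C = "{z \<in> topspace (prod_topology W (subtopology unit_interval K)). H z \<in> topspace B - U}"
    have "closedin (prod_topology W (subtopology unit_interval K)) ?C"
      using HK U by (intro closedin_continuous_map_preimage) auto
    then have "closedin W (fst ` ?C)"
      using closed_map_fst[OF cK] by (auto simp: closed_map_def)
    then have "openin W (topspace W - fst ` ?C)" by blast
    moreover have "topspace W - fst ` ?C =
        ?c -` {\<phi> \<in> maps_set unit_interval B. \<phi> ` K \<subseteq> U} \<inter> topspace W"
    proof -
      have HB: "H (w, t) \<in> topspace B" if "w \<in> topspace W" "t \<in> {0..1}" for w t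
        using H that by (auto simp: continuous_map_def Pi_iff)
      have "w \<in> fst ` ?C \<longleftrightarrow> \<not> ?c w ` K \<subseteq> U" if w: "w \<in> topspace W" for w
      proof -
        have "w \<in> fst ` ?C \<longleftrightarrow> (\<exists>t\<in>K. H (w, t) \<notin> U)"
          using w K01 HB by (force simp: image_iff)
        also have "\<dots> \<longleftrightarrow> \<not> ?c w ` K \<subseteq> U"
          using K01 by (auto simp: image_subset_iff subset_iff)
        finally show ?thesis .
      qed
      then show ?thesis using mem by blast
    qed
    ultimately show ?thesis by simp
  qed
  show ?thesis
    unfolding path_space_def compact_open_topology_def
  proof (rule continuous_on_generated_topo)
    fix S assume "S \<in> {{\<phi> \<in> maps_set unit_interval B. \<phi> ` K \<subseteq> U} |K U.
      compactin unit_interval K \<and> openin B U}"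
    then show "openin W (?c -` S \<inter> topspace W)" using op by blast
  next
    have "topspace (compact_open_topology unit_interval B) = maps_set unit_interval B" by simp
    then show "?c ` topspace W \<subseteq> \<Union> {{\<phi> \<in> maps_set unit_interval B. \<phi> ` K \<subseteq> U} |K U.
      compactin unit_interval K \<and> openin B U}"
      using mem unfolding compact_open_topology_def topology_generated_by_topspace by blast
  qed
qed

lemma hurewicz_fibration_lifting:
  fixes W :: "'w topology" and E :: "'e topology" and B :: "'b topology"
  assumes fib: "hurewicz_fibration E B p"
  shows "homotopy_lifting W E B p"
  unfolding homotopy_lifting_def
proof (intro allI impI, elim conjE)
  fix h H
  assume h: "continuous_map W E h" and H: "continuous_map (prod_topology W unit_interval) B H"
    and hH: "\<forall>w\<in>topspace W. H (w, 0) = p (h w)"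
  define M where "M = subtopology (prod_topology E (path_space B)) {(e, \<gamma>). \<gamma> 0 = p e}"
  have e: "continuous_map M E fst"
    unfolding M_def by (intro continuous_map_from_subtopology continuous_map_fst)
  have "continuous_map M (path_space B) snd"
    unfolding M_def by (intro continuous_map_from_subtopology continuous_map_snd)
  then have "continuous_map (prod_topology M unit_interval) (prod_topology (path_space B) unit_interval)
      (\<lambda>z. (snd (fst z), snd z))"
    using continuous_map_compose[OF continuous_map_fst]
    by (simp add: continuous_map_pairwise o_def continuous_map_snd)
  from continuous_map_compose[OF this continuous_map_path_space_eval]
  have ev: "continuous_map (prod_topology M unit_interval) B (\<lambda>z. snd (fst z) (snd z))"
    by (simp add: o_def case_prod_unfold)
  have "\<forall>w\<in>topspace M. (\<lambda>z. snd (fst z) (snd z)) (w, 0) = p (fst w)"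
    by (auto simp: M_def)
  moreover have "homotopy_lifting M E B p"
    using fib by (simp add: hurewicz_fibration_def)
  ultimately obtain L where L: "continuous_map (prod_topology M unit_interval) E L"
    and L0: "\<forall>w\<in>topspace M. L (w, 0) = fst w"
    and Lp: "\<forall>w\<in>topspace M. \<forall>t\<in>{0..1}. p (L (w, t)) = snd w t"
    using e ev unfolding homotopy_lifting_def
    by (metis (no_types, lifting) fst_conv snd_conv)
  define c where "c = (\<lambda>w. (h w, restrict (\<lambda>t. H (w, t)) {0..1}))"
  have c: "continuous_map W M c"
    unfolding M_def continuous_map_in_subtopology c_def
    using h continuous_map_path_space_curry[OF H] hH by (auto simp: continuous_map_pairwise o_def)
  then have cM: "\<And>w. w \<in> topspace W \<Longrightarrow> c w \<in> topspace M"
    by (auto simp: continuous_map_def)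
  have "continuous_map (prod_topology W unit_interval) (prod_topology M unit_interval)
      (\<lambda>z. (c (fst z), snd z))"
    using continuous_map_compose[OF continuous_map_fst c]
    by (simp add: continuous_map_pairwise o_def continuous_map_snd)
  from continuous_map_compose[OF this L]
  have "continuous_map (prod_topology W unit_interval) E (\<lambda>z. L (c (fst z), snd z))"
    by (simp add: o_def)
  moreover have "\<forall>w\<in>topspace W. L (c w, 0) = h w"
    using L0 cM by (auto simp: c_def)
  moreover have "\<forall>w\<in>topspace W. \<forall>t\<in>{0..1}. p (L (c w, t)) = H (w, t)"
    using Lp cM by (auto simp: c_def)
  ultimately show "\<exists>L. continuous_map (prod_topology W unit_interval) E L \<and>
      (\<forall>w\<in>topspace W. L (w, 0) = h w) \<and>
      (\<forall>w\<in>topspace W. \<forall>t\<in>{0..1}. p (L (w, t)) = H (w, t))"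
    by (intro exI[of _ "\<lambda>z. L (c (fst z), snd z)"]) simp
qed

lemma strict_section_imp_homotopy_section:
  assumes "continuous_map E B p" "strict_section E B p s"
  shows "homotopy_section E B p s"
proof -
  have "continuous_map B B (p \<circ> s)"
    using assms continuous_map_compose by (auto simp: strict_section_def)
  then have "homotopic_with (\<lambda>_. True) B B (p \<circ> s) id"
    using assms(2) by (intro homotopic_with_equal) (auto simp: strict_section_def)
  then show ?thesis using assms(2) by (simp add: strict_section_def homotopy_section_def)
qed

end

theory Submission
  imports Defs
begin

text \<open>The inequality in (1) is an instance of a general one. If \<open>p' : E' \<rightarrow> A\<close>, \<open>q : A \<rightarrow> B\<close> and
  \<open>p : E \<rightarrow> B\<close> are maps and \<open>\<Phi> : E' \<rightarrow> E\<close> satisfies \<open>p \<circ> \<Phi> = q \<circ> p'\<close>, then a local section \<open>\<sigma>\<close> of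
  \<open>q\<close> followed by a local section \<open>s\<close> of \<open>p'\<close> and by \<open>\<Phi>\<close> is a local section of \<open>p\<close>, defined where
  \<open>\<sigma>\<close> lands in the domain of \<open>s\<close>; letting \<open>\<sigma>\<close> and \<open>s\<close> range over optimal covers gives
  \<open>sec p + 1 \<le> (sec p' + 1) * (sec q + 1)\<close> (\<open>sectional_number_composite_le\<close>). It is applied to
  \<open>q = u \<times> v\<close> and to the endpoint maps, with \<open>\<Phi> (\<alpha>, \<beta>) = (u \<circ> \<alpha>, v \<circ> \<beta>)\<close>. Strict sections of \<open>u\<close>
  and \<open>v\<close> make \<open>sec (u \<times> v)\<close> vanish.

  For (2), a local section of the endpoint map over an open \<open>U \<subseteq> X \<times> Y\<close> assigns to a point
  \<open>(x', y')\<close> of the preimage of \<open>U\<close> paths \<open>\<alpha>\<close> from \<open>u x'\<close> and \<open>\<beta>\<close> to \<open>v y'\<close> with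
  \<open>f \<circ> \<alpha> = g \<circ> \<beta>\<close>. Lifting \<open>\<alpha>\<close> to a path from \<open>x'\<close> and \<open>\<beta>\<close> to a path ending at \<open>y'\<close>, continuously
  in \<open>(x', y')\<close>, yields a local section over the preimage (\<open>TC_comp_fibrations_le\<close>).

  For (3), lifting the homotopy \<open>u \<circ> s \<simeq> id\<close> from \<open>s\<close> turns a homotopy section of a fibration into
  a strict one, so that (1) and (2) give the two inequalities.\<close>

section \<open>Sectional numbers\<close>

text \<open>The base is covered by \<open>k + 1\<close> open sets over each of which \<open>p\<close> has a strict local section;
  the sectional number is the least such \<open>k\<close>.\<close>

definition sectional_cover :: "'e topology \<Rightarrow> 'b topology \<Rightarrow> ('e \<Rightarrow> 'b) \<Rightarrow> nat \<Rightarrow> bool"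
  where "sectional_cover E B p k \<longleftrightarrow>
    (\<exists>(U :: nat \<Rightarrow> 'b set) (s :: nat \<Rightarrow> 'b \<Rightarrow> 'e).
      (\<forall>i\<le>k. openin B (U i)) \<and> (\<Union>i\<le>k. U i) = topspace B \<and>
      (\<forall>i\<le>k. continuous_map (subtopology B (U i)) E (s i) \<and> (\<forall>x\<in>U i. p (s i x) = x)))"

lemma sectional_coverE:
  assumes "sectional_cover E B p k"
  obtains U s where "\<And>i. i \<le> k \<Longrightarrow> openin B (U i)" "(\<Union>i\<le>k. U i) = topspace B"
    "\<And>i. i \<le> k \<Longrightarrow> continuous_map (subtopology B (U i)) E (s i)"
    "\<And>i x. i \<le> k \<Longrightarrow> x \<in> U i \<Longrightarrow> p (s i x) = x"
proof -
  obtain U s where "\<forall>i\<le>k. openin B (U i)" "(\<Union>i\<le>k. U i) = topspace B"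
    "\<forall>i\<le>k. continuous_map (subtopology B (U i)) E (s i) \<and> (\<forall>x\<in>U i. p (s i x) = x)"
    using assms unfolding sectional_cover_def by (elim exE conjE)
  then show thesis by (intro that[of U s]) simp_all
qed

lemma sectional_number_eq_Inf: "sectional_number E B p = Inf {enat k | k. sectional_cover E B p k}"
  by (simp add: sectional_number_def sectional_cover_def)

lemma sectional_number_le: "sectional_cover E B p k \<Longrightarrow> sectional_number E B p \<le> enat k"
  unfolding sectional_number_eq_Inf by (rule Inf_lower) blast

lemma sectional_cover_sectional_number:
  assumes "sectional_number E B p = enat k"
  shows "sectional_cover E B p k"
proof -
  let ?A = "{enat k | k. sectional_cover E B p k}"
  have "?A \<noteq> {}" using assms unfolding sectional_number_eq_Inf
    by (auto simp: Inf_enat_def split: if_splits)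
  then have "Inf ?A \<in> ?A" unfolding Inf_enat_def by (auto intro: LeastI)
  then show ?thesis using assms unfolding sectional_number_eq_Inf by auto
qed

lemma sectional_cover_composite:
  assumes p': "sectional_cover E' A p' k" and q: "sectional_cover A B q l"
    and \<Phi>: "continuous_map E' E \<Phi>" and comm: "\<And>e. e \<in> topspace E' \<Longrightarrow> p (\<Phi> e) = q (p' e)"
  shows "sectional_cover E B p ((k + 1) * (l + 1) - 1)"
proof -
  obtain U s where U: "\<And>i. i \<le> k \<Longrightarrow> openin A (U i)" and Ucov: "(\<Union>i\<le>k. U i) = topspace A"
    and s: "\<And>i. i \<le> k \<Longrightarrow> continuous_map (subtopology A (U i)) E' (s i)"
    and sp: "\<And>i x. i \<le> k \<Longrightarrow> x \<in> U i \<Longrightarrow> p' (s i x) = x"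
    by (rule sectional_coverE[OF p']) blast
  obtain V \<sigma> where V: "\<And>j. j \<le> l \<Longrightarrow> openin B (V j)" and Vcov: "(\<Union>j\<le>l. V j) = topspace B"
    and \<sigma>: "\<And>j. j \<le> l \<Longrightarrow> continuous_map (subtopology B (V j)) A (\<sigma> j)"
    and \<sigma>q: "\<And>j x. j \<le> l \<Longrightarrow> x \<in> V j \<Longrightarrow> q (\<sigma> j x) = x"
    by (rule sectional_coverE[OF q]) blast
  define W where "W i j = {b \<in> V j. \<sigma> j b \<in> U i}" for i j
  have Veq: "topspace (subtopology B (V j)) = V j" if "j \<le> l" for j
    using openin_subset[OF V[OF that]] by auto
  have W: "openin B (W i j)" if "i \<le> k" "j \<le> l" for i j
  proof -
    have "openin (subtopology B (V j)) (W i j)"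
      using openin_continuous_map_preimage[OF \<sigma>[OF that(2)] U[OF that(1)]]
      unfolding W_def Veq[OF that(2)] .
    then show ?thesis using V[OF that(2)] by (simp add: openin_open_subtopology)
  qed
  have sec: "continuous_map (subtopology B (W i j)) E (\<lambda>b. \<Phi> (s i (\<sigma> j b)))"
    "\<forall>b\<in>W i j. p (\<Phi> (s i (\<sigma> j b))) = b" if i: "i \<le> k" and j: "j \<le> l" for i j
  proof -
    have "continuous_map (subtopology B (W i j)) A (\<sigma> j)"
      by (rule continuous_map_from_subtopology_mono[OF \<sigma>[OF j]]) (auto simp: W_def)
    then have "continuous_map (subtopology B (W i j)) (subtopology A (U i)) (\<sigma> j)"
      by (auto simp: continuous_map_in_subtopology W_def)
    from continuous_map_compose[OF continuous_map_compose[OF this s[OF i]] \<Phi>]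
    show "continuous_map (subtopology B (W i j)) E (\<lambda>b. \<Phi> (s i (\<sigma> j b)))"
      by (simp add: o_def)
    have "s i a \<in> topspace E'" if "a \<in> U i" for a
      using s[OF i] that openin_subset[OF U[OF i]] by (auto simp: continuous_map_def)
    then show "\<forall>b\<in>W i j. p (\<Phi> (s i (\<sigma> j b))) = b"
      using comm sp[OF i] \<sigma>q[OF j] by (simp add: W_def)
  qed
  \<comment> \<open>The pairs \<open>(i, j)\<close> with \<open>i \<le> k\<close> and \<open>j \<le> l\<close> are numbered by \<open>j * (k + 1) + i\<close>.\<close>
  define I where "I n = n mod (k + 1)" for n
  define J where "J n = n div (k + 1)" for n
  have I: "I n \<le> k" for n
    using mod_less_divisor[of "k + 1" n] by (simp add: I_def)
  have J: "J n \<le> l" if "n \<le> (k + 1) * (l + 1) - 1" for n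
  proof -
    have "n < (l + 1) * (k + 1)" using that by (simp add: algebra_simps)
    then have "J n < l + 1" unfolding J_def by (rule less_mult_imp_div_less)
    then show ?thesis by simp
  qed
  have "(\<Union>n\<le>(k + 1) * (l + 1) - 1. W (I n) (J n)) = topspace B" (is "?L = _")
  proof
    show "?L \<subseteq> topspace B" using W I J openin_subset by blast
    show "topspace B \<subseteq> ?L"
    proof
      fix b assume "b \<in> topspace B"
      then obtain j where j: "j \<le> l" "b \<in> V j" using Vcov by blast
      then have "\<sigma> j b \<in> topspace A"
        using \<sigma>[OF j(1)] Veq[OF j(1)] by (auto simp: continuous_map_def)
      then obtain i where i: "i \<le> k" "\<sigma> j b \<in> U i" using Ucov by blast
      have "j * (k + 1) + i \<le> l * (k + 1) + k"
        using i(1) j(1) by (intro add_mono mult_right_mono) auto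
      then have "j * (k + 1) + i \<le> (k + 1) * (l + 1) - 1" by (simp add: algebra_simps)
      moreover have "I (j * (k + 1) + i) = i" "J (j * (k + 1) + i) = j"
        unfolding I_def J_def using i(1) div_mult_self3[of "k + 1" j i]
        by (simp_all add: mod_mult_self3 del: mult_Suc_right)
      ultimately show "b \<in> ?L" using i j by (force simp: W_def)
    qed
  qed
  then show ?thesis
    unfolding sectional_cover_def
    by (intro exI[of _ "\<lambda>n. W (I n) (J n)"] exI[of _ "\<lambda>n b. \<Phi> (s (I n) (\<sigma> (J n) b))"])
      (simp add: W I J sec)
qed

lemma sectional_number_composite_le:
  assumes "continuous_map E' E \<Phi>" and "\<And>e. e \<in> topspace E' \<Longrightarrow> p (\<Phi> e) = q (p' e)"
  shows "sectional_number E B p + 1 \<le> (sectional_number E' A p' + 1) * (sectional_number A B q + 1)"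
proof (cases "sectional_number E' A p'")
  case k: (enat k)
  show ?thesis
  proof (cases "sectional_number A B q")
    case l: (enat l)
    have "sectional_cover E B p ((k + 1) * (l + 1) - 1)"
      using k l assms by (intro sectional_cover_composite sectional_cover_sectional_number)
    then have "sectional_number E B p + 1 \<le> enat ((k + 1) * (l + 1) - 1) + 1"
      by (intro add_right_mono sectional_number_le)
    then show ?thesis using k l by (simp add: one_enat_def)
  qed (simp add: k one_enat_def imult_is_infinity)
next
  case infinity
  have "0 < sectional_number A B q + 1" by (simp add: plus_1_eSuc)
  then show ?thesis by (simp add: infinity imult_infinity)
qed

lemma sectional_number_eq_0_if_strict_section:
  assumes "strict_section E B p s"
  shows "sectional_number E B p = 0"
proof -
  have "sectional_cover E B p 0"
    unfolding sectional_cover_def using assms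
    by (intro exI[of _ "\<lambda>_. topspace B"] exI[of _ "\<lambda>_. s"]) (simp add: strict_section_def)
  from sectional_number_le[OF this] show ?thesis by (simp add: zero_enat_def[symmetric])
qed

lemma strict_section_map_prod:
  assumes "strict_section E A p s" and "strict_section F B q t"
  shows "strict_section (prod_topology E F) (prod_topology A B) (map_prod p q) (map_prod s t)"
  using assms unfolding strict_section_def
  by (auto simp: map_prod_def case_prod_unfold continuous_map_pairwise o_def
      intro: continuous_map_compose[OF continuous_map_fst, unfolded o_def]
        continuous_map_compose[OF continuous_map_snd, unfolded o_def])

section \<open>Families of paths\<close>

lemma continuous_map_path_space_uncurry:
  assumes "continuous_map W (path_space X) c"
  shows "continuous_map (prod_topology W unit_interval) X (\<lambda>z. c (fst z) (snd z))"
proof -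
  have "continuous_map (prod_topology W unit_interval) (prod_topology (path_space X) unit_interval)
      (\<lambda>z. (c (fst z), snd z))"
    using continuous_map_compose[OF continuous_map_fst assms]
    by (simp add: continuous_map_pairwise o_def continuous_map_snd)
  from continuous_map_compose[OF this continuous_map_path_space_eval]
  show ?thesis by (simp add: o_def)
qed

text \<open>Points of a path space are \<^const>\<open>undefined\<close> outside \<open>[0, 1]\<close>, hence the restriction of the
  composed paths.\<close>

lemma continuous_map_path_space_postcompose:
  assumes "continuous_map W (path_space X') c" and "continuous_map X' X u"
  shows "continuous_map W (path_space X) (\<lambda>w. restrict (\<lambda>t. u (c w t)) {0..1})"
  using continuous_map_path_space_curry[OF continuous_map_compose
      [OF continuous_map_path_space_uncurry[OF assms(1)] assms(2)]]
  by simp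

lemma continuous_map_prod_reverse_time:
  "continuous_map (prod_topology W unit_interval) (prod_topology W unit_interval)
    (\<lambda>z. (fst z, 1 - snd z))"
proof -
  have "continuous_map unit_interval unit_interval (\<lambda>t::real. 1 - t)"
    by (auto simp: continuous_map_in_subtopology intro: continuous_on_op_minus)
  from continuous_map_compose[OF continuous_map_snd this]
  show ?thesis by (simp add: continuous_map_pairwise o_def continuous_map_fst)
qed

section \<open>Lifting along fibrations\<close>

text \<open>A continuous family of paths lifts along a fibration, with prescribed initial points.\<close>

lemma fibration_lift_path_family:
  assumes "hurewicz_fibration E B p" and h: "continuous_map W E h"
    and c: "continuous_map W (path_space B) c"
    and start: "\<And>w. w \<in> topspace W \<Longrightarrow> c w 0 = p (h w)"
  obtains d where "continuous_map W (path_space E) d" "\<And>w. w \<in> topspace W \<Longrightarrow> d w 0 = h w"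
    "\<And>w t. w \<in> topspace W \<Longrightarrow> t \<in> {0..1} \<Longrightarrow> p (d w t) = c w t"
proof -
  \<comment> \<open>A family of paths indexed by \<open>W\<close> is a homotopy on \<open>W\<close>.\<close>
  have "homotopy_lifting W E B p" by (rule hurewicz_fibration_lifting[OF assms(1)])
  then obtain L where L: "continuous_map (prod_topology W unit_interval) E L"
    "\<forall>w\<in>topspace W. L (w, 0) = h w" "\<forall>w\<in>topspace W. \<forall>t\<in>{0..1}. p (L (w, t)) = c w t"
    using h continuous_map_path_space_uncurry[OF c] start unfolding homotopy_lifting_def
    by (metis (no_types, lifting) fst_conv snd_conv)
  show thesis
    by (rule that[OF continuous_map_path_space_curry[OF L(1)]]) (use L in auto)
qed

lemma continuous_map_path_space_reverse:
  assumes "continuous_map W (path_space X) c"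
  shows "continuous_map W (path_space X) (\<lambda>w. restrict (\<lambda>t. c w (1 - t)) {0..1})"
  using continuous_map_path_space_curry[OF continuous_map_compose
      [OF continuous_map_prod_reverse_time continuous_map_path_space_uncurry[OF assms]]]
  by simp

text \<open>Lifting with prescribed terminal points, by lifting the reversed paths from these points.\<close>

lemma fibration_lift_path_family_end:
  assumes fib: "hurewicz_fibration E B p" and h: "continuous_map W E h"
    and c: "continuous_map W (path_space B) c"
    and "end": "\<And>w. w \<in> topspace W \<Longrightarrow> c w 1 = p (h w)"
  obtains d where "continuous_map W (path_space E) d" "\<And>w. w \<in> topspace W \<Longrightarrow> d w 1 = h w"
    "\<And>w t. w \<in> topspace W \<Longrightarrow> t \<in> {0..1} \<Longrightarrow> p (d w t) = c w t"
proof -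
  obtain d where d: "continuous_map W (path_space E) d" "\<And>w. w \<in> topspace W \<Longrightarrow> d w 0 = h w"
    "\<And>w t. w \<in> topspace W \<Longrightarrow> t \<in> {0..1} \<Longrightarrow> p (d w t) = restrict (\<lambda>t. c w (1 - t)) {0..1} t"
    by (rule fibration_lift_path_family[OF fib h continuous_map_path_space_reverse[OF c]])
      (simp_all add: "end")
  show thesis
    by (rule that[OF continuous_map_path_space_reverse[OF d(1)]]) (use d in auto)
qed

lemma strict_section_if_homotopy_section:
  assumes fib: "hurewicz_fibration E B p" and "homotopy_section E B p s"
  shows "\<exists>s'. strict_section E B p s'"
proof -
  obtain H where s: "continuous_map B E s"
    and H: "continuous_map (prod_topology unit_interval B) B H"
    and H0: "\<And>x. H (0, x) = p (s x)" and H1: "\<And>x. H (1, x) = x"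
    using assms(2) unfolding homotopy_section_def homotopic_with_def by auto
  have "continuous_map (prod_topology B unit_interval) B (\<lambda>z. H (snd z, fst z))"
    using continuous_map_compose[OF _ H, of "prod_topology B unit_interval" "\<lambda>z. (snd z, fst z)"]
    by (simp add: continuous_map_pairwise o_def continuous_map_fst continuous_map_snd)
  moreover have "homotopy_lifting B E B p" by (rule hurewicz_fibration_lifting[OF fib])
  \<comment> \<open>The lifted homotopy starts at \<open>s\<close> and ends at a strict section.\<close>
  ultimately obtain L where L: "continuous_map (prod_topology B unit_interval) E L"
    and pL: "\<forall>x\<in>topspace B. \<forall>t\<in>{0..1}. p (L (x, t)) = H (t, x)"
    using s H0 unfolding homotopy_lifting_def by (metis (no_types, lifting) fst_conv snd_conv)
  have "continuous_map B (prod_topology B unit_interval) (\<lambda>x. (x, 1))"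
    by (simp add: continuous_map_pairwise o_def)
  from continuous_map_compose[OF this L] have "continuous_map B E (\<lambda>x. L (x, 1))"
    by (simp add: o_def)
  then have "strict_section E B p (\<lambda>x. L (x, 1))"
    using pL H1 by (simp add: strict_section_def)
  then show ?thesis by blast
qed

section \<open>Bivariate topological complexity\<close>

lemma continuous_map_path_pullback_iff:
  "continuous_map W (path_pullback X Y f g) c \<longleftrightarrow>
    continuous_map W (path_space X) (\<lambda>w. fst (c w)) \<and>
    continuous_map W (path_space Y) (\<lambda>w. snd (c w)) \<and>
    (\<forall>w\<in>topspace W. \<forall>t\<in>{0..1}. f (fst (c w) t) = g (snd (c w) t))"
  unfolding path_pullback_def continuous_map_in_subtopology
  by (auto simp: continuous_map_pairwise o_def case_prod_unfold)

lemma TC_comp_times_sectional_number_ge: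
  fixes X' :: "'u topology" and Y' :: "'v topology"
  assumes u: "continuous_map X' X u" and v: "continuous_map Y' Y v"
  shows "TC X Y f g + 1 \<le> (TC X' Y' (f \<circ> u) (g \<circ> v) + 1) *
    (sectional_number (prod_topology X' Y') (prod_topology X Y) (map_prod u v) + 1)"
proof -
  let ?E = "path_pullback X' Y' (f \<circ> u) (g \<circ> v)"
  define \<Phi> where "\<Phi> c = (restrict (\<lambda>t. u (fst c t)) {0..1}, restrict (\<lambda>t. v (snd c t)) {0..1})"
    for c :: "(real \<Rightarrow> 'u) \<times> (real \<Rightarrow> 'v)"
  have E: "continuous_map ?E (path_space X') fst" "continuous_map ?E (path_space Y') snd"
    "\<forall>c\<in>topspace ?E. \<forall>t\<in>{0..1}. f (u (fst c t)) = g (v (snd c t))"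
    using continuous_map_path_pullback_iff[of ?E X' Y' "f \<circ> u" "g \<circ> v" "\<lambda>z. z"] by auto
  have "continuous_map ?E (path_pullback X Y f g) \<Phi>"
    unfolding continuous_map_path_pullback_iff \<Phi>_def
    using continuous_map_path_space_postcompose[OF E(1) u]
      continuous_map_path_space_postcompose[OF E(2) v] E(3) by simp
  then show ?thesis
    unfolding TC_def
    by (rule sectional_number_composite_le) (simp add: \<Phi>_def endpoint_map_def case_prod_unfold)
qed

lemma TC_comp_fibrations_le:
  assumes fu: "hurewicz_fibration X' X u" and fv: "hurewicz_fibration Y' Y v"
  shows "TC X' Y' (f \<circ> u) (g \<circ> v) \<le> TC X Y f g"
proof (cases "TC X Y f g")
  case (enat k)
  let ?B' = "prod_topology X' Y'"
  obtain U s where U: "\<And>i. i \<le> k \<Longrightarrow> openin (prod_topology X Y) (U i)"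
    and Ucov: "(\<Union>i\<le>k. U i) = topspace (prod_topology X Y)"
    and s: "\<And>i. i \<le> k \<Longrightarrow> continuous_map (subtopology (prod_topology X Y) (U i))
      (path_pullback X Y f g) (s i)"
    and sp: "\<And>i z. i \<le> k \<Longrightarrow> z \<in> U i \<Longrightarrow> endpoint_map (s i z) = z"
    by (rule sectional_coverE[OF sectional_cover_sectional_number[OF enat[unfolded TC_def]]]) blast
  define b where "b z = (u (fst z), v (snd z))" for z
  have "continuous_map X' X u" "continuous_map Y' Y v"
    using fu fv by (simp_all add: hurewicz_fibration_def)
  then have b: "continuous_map ?B' (prod_topology X Y) b"
    unfolding b_def using continuous_map_compose[OF continuous_map_fst]
      continuous_map_compose[OF continuous_map_snd]
    by (auto simp: continuous_map_pairwise o_def)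
  \<comment> \<open>\<open>b = u \<times> v\<close>; the cover of \<open>X' \<times> Y'\<close> consists of the preimages of the \<open>U i\<close>.\<close>
  define U' where "U' i = {z \<in> topspace ?B'. b z \<in> U i}" for i
  have U': "openin ?B' (U' i)" if "i \<le> k" for i
    unfolding U'_def using b U[OF that] by (rule openin_continuous_map_preimage)
  have cov: "(\<Union>i\<le>k. U' i) = topspace ?B'"
  proof -
    have "b z \<in> (\<Union>i\<le>k. U i)" if "z \<in> topspace ?B'" for z
      unfolding Ucov using b that by (auto simp: continuous_map_def)
    then show ?thesis by (auto simp: U'_def)
  qed
  have "\<exists>s'. continuous_map (subtopology ?B' (U' i)) (path_pullback X' Y' (f \<circ> u) (g \<circ> v)) s' \<and>
      (\<forall>z\<in>U' i. endpoint_map (s' z) = z)" if i: "i \<le> k" for i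
  proof -
    let ?W = "subtopology ?B' (U' i)"
    have W: "topspace ?W = U' i" using openin_subset[OF U'[OF i]] by auto
    have "continuous_map ?W (subtopology (prod_topology X Y) (U i)) b"
      using continuous_map_from_subtopology[OF b]
      by (auto simp: continuous_map_in_subtopology U'_def)
    from continuous_map_compose[OF this s[OF i]]
    have c: "continuous_map ?W (path_space X) (\<lambda>z. fst (s i (b z)))"
      "continuous_map ?W (path_space Y) (\<lambda>z. snd (s i (b z)))"
      "\<And>z t. z \<in> U' i \<Longrightarrow> t \<in> {0..1} \<Longrightarrow> f (fst (s i (b z)) t) = g (snd (s i (b z)) t)"
      unfolding continuous_map_path_pullback_iff W by auto
    have ends: "fst (s i (b z)) 0 = u (fst z)" "snd (s i (b z)) 1 = v (snd z)"
      if "z \<in> U' i" for z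
      using sp[OF i, of "b z"] that
      by (auto simp: U'_def b_def endpoint_map_def case_prod_unfold)
    have hW: "continuous_map ?W X' fst" "continuous_map ?W Y' snd"
      by (intro continuous_map_from_subtopology continuous_map_fst continuous_map_snd)+
    \<comment> \<open>\<open>\<alpha>\<close> is lifted from its start and \<open>\<beta>\<close> from its end, the endpoints seen by the endpoint map.\<close>
    obtain d where d: "continuous_map ?W (path_space X') d" "\<And>z. z \<in> U' i \<Longrightarrow> d z 0 = fst z"
      "\<And>z t. z \<in> U' i \<Longrightarrow> t \<in> {0..1} \<Longrightarrow> u (d z t) = fst (s i (b z)) t"
      using fibration_lift_path_family[OF fu hW(1) c(1)] ends(1) unfolding W by blast
    obtain e where e: "continuous_map ?W (path_space Y') e" "\<And>z. z \<in> U' i \<Longrightarrow> e z 1 = snd z"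
      "\<And>z t. z \<in> U' i \<Longrightarrow> t \<in> {0..1} \<Longrightarrow> v (e z t) = snd (s i (b z)) t"
      using fibration_lift_path_family_end[OF fv hW(2) c(2)] ends(2) unfolding W by blast
    show ?thesis
      by (intro exI[of _ "\<lambda>z. (d z, e z)"])
        (auto simp: continuous_map_path_pullback_iff W[simplified] d e c endpoint_map_def)
  qed
  then obtain s' where
    "\<forall>i\<le>k. continuous_map (subtopology ?B' (U' i)) (path_pullback X' Y' (f \<circ> u) (g \<circ> v)) (s' i) \<and>
      (\<forall>z\<in>U' i. endpoint_map (s' i z) = z)"
    by metis
  then have "sectional_cover (path_pullback X' Y' (f \<circ> u) (g \<circ> v)) ?B' endpoint_map k"
    unfolding sectional_cover_def using U' cov by blast
  from sectional_number_le[OF this] show ?thesis unfolding enat by (simp add: TC_def)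
qed simp

lemma TC_le_comp_if_strict_sections:
  assumes u: "continuous_map X' X u" and v: "continuous_map Y' Y v"
    and "strict_section X' X u s" and "strict_section Y' Y v t"
  shows "TC X Y f g \<le> TC X' Y' (f \<circ> u) (g \<circ> v)"
  using TC_comp_times_sectional_number_ge[OF u v, of f g]
    sectional_number_eq_0_if_strict_section[OF strict_section_map_prod[OF assms(3,4)]]
  by simp

theorem proposition2p24:
  fixes X :: "'x topology" and Y :: "'y topology" and Z :: "'z topology"
    and X' :: "'u topology" and Y' :: "'v topology"
    and f :: "'x \<Rightarrow> 'z" and g :: "'y \<Rightarrow> 'z" and u :: "'u \<Rightarrow> 'x" and v :: "'v \<Rightarrow> 'y"
  assumes "continuous_map X Z f" and "continuous_map Y Z g"
    and "continuous_map X' X u" and "continuous_map Y' Y v"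
  shows "(TC X' Y' (f \<circ> u) (g \<circ> v) + 1) *
           (sectional_number (prod_topology X' Y') (prod_topology X Y) (map_prod u v) + 1)
         \<ge> TC X Y f g + 1 \<and>
         ((\<exists>s. strict_section X' X u s) \<and> (\<exists>s. strict_section Y' Y v s) \<longrightarrow>
           TC X Y f g \<le> TC X' Y' (f \<circ> u) (g \<circ> v)) \<and>
         (hurewicz_fibration X' X u \<and> hurewicz_fibration Y' Y v \<longrightarrow>
           TC X' Y' (f \<circ> u) (g \<circ> v) \<le> TC X Y f g) \<and>
         (hurewicz_fibration X' X u \<and> hurewicz_fibration Y' Y v \<and>
           (\<exists>s. homotopy_section X' X u s) \<and> (\<exists>s. homotopy_section Y' Y v s) \<longrightarrow>
           TC X' Y' (f \<circ> u) (g \<circ> v) = TC X Y f g)"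
  using TC_comp_times_sectional_number_ge[OF assms(3,4), of f g]
    TC_le_comp_if_strict_sections[OF assms(3,4), of _ _ f g]
    TC_comp_fibrations_le[of X' X u Y' Y v f g]
    strict_section_if_homotopy_section[of X' X u] strict_section_if_homotopy_section[of Y' Y v]
  by (blast intro: order_antisym)

end
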